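(* Let $G$ be a finite group of nonzero spread. Then $\mathrm{Aut}^*(G)=\mathrm{Aut}(G)$ if and only if $G$ is nonabelian.
   Context: A finite group $G$ has nonzero spread if for every nonidentity element $s\in G$ there exists $x\in G$ with $\langle x,s\rangle=G$. The generating graph $\Gamma(G)$ has vertex set $G$, with $x$ and $y$ joined if and only if $\langle x,y\rangle=G$; if $G$ is cyclic then every generator of $G$ carries a loop. For $x,y\in G$, $x\equiv_\Gamma y$ means that $x$ and $y$ have the same set of neighbours in $\Gamma(G)$. The reduced generating graph $\overline{\Gamma}(G)$ has as vertices the $\equiv_\Gamma$-classes, two classes being joined if their vertices are joined in $\Gamma(G)$. Automorphisms of $G$ permute the $\equiv_\Gamma$-classes, and $\mathrm{Aut}^*(G)$ denotes the group induced by $\mathrm{Aut}(G)$ on $\overline{\Gamma}(G)$. The equality $\mathrm{Aut}^*(G)=\mathrm{Aut}(G)$ means that the natural surjection $\mathrm{Aut}(G)\to\mathrm{Aut}^*(G)$ is an isomorphism, i.e. only the identity automorphism of $G$ fixes every $\equiv_\Gamma$-class.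
   Formalization: The claim is false for the abelian groups 1, C_2 and C_2×C_2, which have nonzero spread and satisfy Aut*(G)=Aut(G); exactly these three groups (up to isomorphism) are excluded. *)

theory Defs
  imports "HOL-Algebra.Algebra" "Graph_Theory.Pair_Digraph"
begin

definition nonzero_spread :: "('a, 'b) monoid_scheme \<Rightarrow> bool" where
  "nonzero_spread G \<longleftrightarrow>
     (\<forall>s\<in>carrier G. s \<noteq> \<one>\<^bsub>G\<^esub> \<longrightarrow> (\<exists>x\<in>carrier G. generate G {x, s} = carrier G))"

text \<open>Graphs are symmetric digraphs. The vertices \<open>x\<close> and \<open>y\<close> are allowed to coincide, so
  that \<open>x\<close> carries a loop exactly when it generates the (then cyclic) group.\<close>

definition generating_graph :: "('a, 'b) monoid_scheme \<Rightarrow> 'a pair_pre_digraph" where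
  "generating_graph G =
     \<lparr>pverts = carrier G,
      parcs = {(x, y). x \<in> carrier G \<and> y \<in> carrier G \<and> generate G {x, y} = carrier G}\<rparr>"

definition same_nbrs :: "'v pair_pre_digraph \<Rightarrow> 'v rel" where
  "same_nbrs \<Gamma> =
     {(x, y). x \<in> pverts \<Gamma> \<and> y \<in> pverts \<Gamma> \<and> parcs \<Gamma> `` {x} = parcs \<Gamma> `` {y}}"

definition reduced_graph :: "'v pair_pre_digraph \<Rightarrow> 'v set pair_pre_digraph" where
  "reduced_graph \<Gamma> =
     \<lparr>pverts = pverts \<Gamma> // same_nbrs \<Gamma>,
      parcs = {(C, D). C \<in> pverts \<Gamma> // same_nbrs \<Gamma> \<and> D \<in> pverts \<Gamma> // same_nbrs \<Gamma> \<and>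
                       (\<exists>x\<in>C. \<exists>y\<in>D. (x, y) \<in> parcs \<Gamma>)}\<rparr>"

abbreviation reduced_generating_graph :: "('a, 'b) monoid_scheme \<Rightarrow> 'a set pair_pre_digraph" where
  "reduced_generating_graph G \<equiv> reduced_graph (generating_graph G)"

text \<open>The permutation of the classes induced by an automorphism; it is restricted to the vertices
  of the reduced graph because \<^const>\<open>BijGroup\<close> consists of extensional functions.\<close>

definition class_action :: "('a, 'b) monoid_scheme \<Rightarrow> ('a \<Rightarrow> 'a) \<Rightarrow> 'a set \<Rightarrow> 'a set" where
  "class_action G \<phi> = (\<lambda>C\<in>pverts (reduced_generating_graph G). \<phi> ` C)"

definition AutStar :: "('a, 'b) monoid_scheme \<Rightarrow> ('a set \<Rightarrow> 'a set) monoid" where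
  "AutStar G = BijGroup (pverts (reduced_generating_graph G))
     \<lparr>carrier := class_action G ` carrier (AutoGroup G)\<rparr>"

text \<open>The equality \<open>Aut\<^sup>*(G) = Aut(G)\<close>: the natural surjection is an isomorphism.\<close>

definition AutStar_eq_Aut :: "('a, 'b) monoid_scheme \<Rightarrow> bool" where
  "AutStar_eq_Aut G \<longleftrightarrow> class_action G \<in> iso (AutoGroup G) (AutStar G)"

end

theory Submission
  imports Defs
begin

text \<open>An automorphism \<open>\<alpha>\<close> acts trivially on the classes iff \<open>\<alpha> x \<equiv> x\<close> for all \<open>x\<close>.

  If \<open>G\<close> is abelian, inversion is such an automorphism, so it must be the identity; a
  2-generated group of exponent 2 is one of the three excluded groups.

  If \<open>\<alpha>\<close> is a nontrivial such automorphism, say \<open>\<alpha> g \<noteq> g\<close>, then conjugation by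
  \<open>\<alpha> g \<otimes> inv g\<close> fixes all classes as well, so the normal subgroup of all elements with this
  property contains a minimal normal subgroup \<open>N\<close>. Choose \<open>\<one> \<noteq> s \<in> N\<close> and \<open>x\<close> with
  \<open>\<langle>x, s\<rangle> = G\<close>, and let \<open>T\<close> be the set of those \<open>m \<in> N\<close> for which \<open>w\<close> and \<open>w \<otimes> m\<close> are
  always simultaneously partners of \<open>x\<close>. It is a normal subgroup of \<open>G\<close> containing all commutators
  of \<open>x\<close> with elements of \<open>N\<close>. If \<open>T\<close> is trivial then \<open>x\<close> commutes with \<open>s\<close>; otherwise \<open>T = N\<close>
  contains \<open>inv s\<close>, and \<open>\<langle>x, \<one>\<rangle> = G\<close>. In both cases \<open>G\<close> is abelian.\<close>

section \<open>Generating pairs and their classes\<close>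

lemma pverts_generating_graph [simp]: "pverts (generating_graph G) = carrier G"
  by (simp add: generating_graph_def)

lemma same_nbrs_generating_graph_iff:
  "(x, y) \<in> same_nbrs (generating_graph G) \<longleftrightarrow>
     x \<in> carrier G \<and> y \<in> carrier G \<and>
     (\<forall>z\<in>carrier G. generate G {x, z} = carrier G \<longleftrightarrow> generate G {y, z} = carrier G)"
  by (auto simp: same_nbrs_def generating_graph_def)

lemma equiv_same_nbrs: "equiv (pverts \<Gamma>) (same_nbrs \<Gamma>)"
  by (rule equivI) (auto simp: same_nbrs_def refl_on_def sym_def trans_def)

context group
begin

lemma inv_cancel_left:
  assumes "a \<in> carrier G" "b \<in> carrier G"
  shows "a \<otimes> (inv a \<otimes> b) = b" "inv a \<otimes> (a \<otimes> b) = b"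
  using assms by (simp_all add: m_assoc [symmetric])

lemma generate_pair_eqI:
  assumes "x \<in> carrier G" "y \<in> carrier G" "a \<in> carrier G" "b \<in> carrier G"
    and "a \<in> generate G {x, y}" "b \<in> generate G {x, y}"
    and "x \<in> generate G {a, b}" "y \<in> generate G {a, b}"
  shows "generate G {x, y} = generate G {a, b}"
  using assms by (intro equalityI generate_subgroup_incl generate_is_subgroup) auto

text \<open>Each generator pair recovers the other by multiplying with \<open>x\<close> or
  \<open>inv x\<close>. So the partners of \<open>x\<close> are closed under right multiplication by
  \<open>x\<close>, which lets powers of \<open>x\<close> at the end of a word be dropped
  later.\<close>

lemma generate_pair_mult:
  assumes x: "x \<in> carrier G" and w: "w \<in> carrier G"
  shows "generate G {x, w \<otimes> x} = generate G {x, w}"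
proof (rule generate_pair_eqI)
  have "(w \<otimes> x) \<otimes> inv x \<in> generate G {x, w \<otimes> x}"
    by (intro generate.eng generate.inv generate.incl) auto
  then show "w \<in> generate G {x, w \<otimes> x}"
    using x w by (simp add: m_assoc)
qed (use x w in \<open>auto intro: generate.intros\<close>)

text \<open>The centralizer of \<open>g\<close> is a subgroup; the induction replays its closure
  properties.\<close>

lemma commutes_generate:
  assumes "g \<in> carrier G" "S \<subseteq> carrier G" and S: "\<And>h. h \<in> S \<Longrightarrow> g \<otimes> h = h \<otimes> g"
    and "k \<in> generate G S"
  shows "g \<otimes> k = k \<otimes> g"
  using assms(4)
proof (induction rule: generate.induct)
  case (inv h)
  then have h: "h \<in> carrier G" "g \<otimes> h = h \<otimes> g" using assms by auto
  have "g \<otimes> inv h = inv h \<otimes> (h \<otimes> g) \<otimes> inv h"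
    using h(1) assms(1) by (simp add: m_assoc [symmetric])
  also have "\<dots> = inv h \<otimes> g"
    using h(1) assms(1) by (simp add: h(2) [symmetric] m_assoc)
  finally show ?case .
next
  case (eng h1 h2)
  then have "h1 \<in> carrier G" "h2 \<in> carrier G"
    using assms generate_incl by blast+
  then show ?case using eng.IH assms(1) by (metis m_assoc)
qed (use assms in auto)

lemma comm_group_generating_pair:
  assumes x: "x \<in> carrier G" and s: "s \<in> carrier G"
    and gen: "generate G {x, s} = carrier G" and comm: "x \<otimes> s = s \<otimes> x"
  shows "comm_group G"
proof (rule group_comm_groupI)
  \<comment> \<open>The centralizer argument runs twice: commuting generators are central, and then
    any element, commuting with the generators, commutes with everything.\<close>
  have central: "h \<otimes> k = k \<otimes> h" if "h \<in> {x, s}" "k \<in> carrier G" for h k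
    by (rule commutes_generate [of _ "{x, s}"]) (use that x s gen comm in auto)
  fix g k assume "g \<in> carrier G" "k \<in> carrier G"
  show "g \<otimes> k = k \<otimes> g"
    by (rule commutes_generate [of _ "{x, s}"])
      (use \<open>g \<in> carrier G\<close> \<open>k \<in> carrier G\<close> x s gen central [symmetric] in auto)
qed

text \<open>Images of generators generate the image subgroup, and injectivity keeps a proper
  subgroup proper.\<close>

lemma generate_pair_auto_iff:
  assumes \<phi>: "\<phi> \<in> auto G" and x: "x \<in> carrier G" and y: "y \<in> carrier G"
  shows "generate G {\<phi> x, \<phi> y} = carrier G \<longleftrightarrow> generate G {x, y} = carrier G"
proof -
  have hom: "\<phi> \<in> hom G G" and bij: "bij_betw \<phi> (carrier G) (carrier G)"
    using \<phi> by (auto simp: auto_def Bij_def)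
  interpret \<phi>: group_hom G G \<phi>
    by unfold_locales (rule hom)
  have "generate G {\<phi> x, \<phi> y} = \<phi> ` generate G {x, y}"
    using \<phi>.generate_img [of "{x, y}"] x y by simp
  moreover have "\<phi> ` generate G {x, y} = \<phi> ` carrier G \<longleftrightarrow> generate G {x, y} = carrier G"
    using x y by (intro inj_on_image_eq_iff [OF bij_betw_imp_inj_on [OF bij]] generate_incl) auto
  ultimately show ?thesis
    using bij by (simp add: bij_betw_def)
qed

lemma same_nbrs_auto_iff:
  assumes \<phi>: "\<phi> \<in> auto G" and x: "x \<in> carrier G" and y: "y \<in> carrier G"
  shows "(\<phi> x, \<phi> y) \<in> same_nbrs (generating_graph G) \<longleftrightarrow>
    (x, y) \<in> same_nbrs (generating_graph G)"
proof -
  have img: "\<phi> ` carrier G = carrier G"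
    using \<phi> by (auto simp: auto_def Bij_def bij_betw_def)
  \<comment> \<open>Since \<open>\<phi>\<close> is onto, the neighbours \<open>z\<close> may be
    taken of the form \<open>\<phi> z\<close>.\<close>
  have "(\<forall>z\<in>\<phi> ` carrier G.
        generate G {\<phi> x, z} = carrier G \<longleftrightarrow> generate G {\<phi> y, z} = carrier G) \<longleftrightarrow>
      (\<forall>z\<in>carrier G.
        generate G {\<phi> x, \<phi> z} = carrier G \<longleftrightarrow> generate G {\<phi> y, \<phi> z} = carrier G)"
    by simp
  moreover have "\<phi> x \<in> carrier G" "\<phi> y \<in> carrier G"
    using img x y by auto
  ultimately show ?thesis
    using x y by (simp add: img same_nbrs_generating_graph_iff generate_pair_auto_iff [OF \<phi>])
qed

text \<open>Conjugation is restricted to the carrier because members of \<open>auto G\<close> are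
  extensional.\<close>

lemma conj_in_auto:
  assumes g: "g \<in> carrier G"
  shows "(\<lambda>x\<in>carrier G. g \<otimes> x \<otimes> inv g) \<in> auto G"
proof -
  have "bij_betw (\<lambda>x\<in>carrier G. g \<otimes> x \<otimes> inv g) (carrier G) (carrier G)"
    by (rule bij_betwI [where g = "\<lambda>x. inv g \<otimes> x \<otimes> g"])
      (use g in \<open>auto simp: m_assoc inv_cancel_left\<close>)
  moreover have "(\<lambda>x\<in>carrier G. g \<otimes> x \<otimes> inv g) \<in> hom G G"
  proof (rule homI)
    fix x y assume "x \<in> carrier G" "y \<in> carrier G"
    then show "(\<lambda>x\<in>carrier G. g \<otimes> x \<otimes> inv g) (x \<otimes> y) =
      (\<lambda>x\<in>carrier G. g \<otimes> x \<otimes> inv g) x \<otimes> (\<lambda>x\<in>carrier G. g \<otimes> x \<otimes> inv g) y"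
      using g by (simp add: m_assoc inv_cancel_left)
  qed (use g in auto)
  ultimately show ?thesis
    by (simp add: auto_def Bij_def)
qed

lemma same_nbrs_conj_iff:
  assumes "g \<in> carrier G" "x \<in> carrier G" "y \<in> carrier G"
  shows "(g \<otimes> x \<otimes> inv g, g \<otimes> y \<otimes> inv g) \<in> same_nbrs (generating_graph G) \<longleftrightarrow>
    (x, y) \<in> same_nbrs (generating_graph G)"
  using same_nbrs_auto_iff [OF conj_in_auto [of g], of x y] assms by simp

section \<open>The action on the classes\<close>

lemma pverts_reduced_generating_graph:
  "pverts (reduced_generating_graph G) = carrier G // same_nbrs (generating_graph G)"
  by (simp add: reduced_graph_def)

lemma auto_image_class:
  assumes \<phi>: "\<phi> \<in> auto G" and x: "x \<in> carrier G"
  shows "\<phi> ` (same_nbrs (generating_graph G) `` {x}) = same_nbrs (generating_graph G) `` {\<phi> x}"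
proof (intro equalityI subsetI)
  fix y assume "y \<in> same_nbrs (generating_graph G) `` {\<phi> x}"
  then have y: "(\<phi> x, y) \<in> same_nbrs (generating_graph G)" "y \<in> carrier G"
    by (auto simp: same_nbrs_generating_graph_iff)
  then obtain z where "z \<in> carrier G" "y = \<phi> z"
    using \<phi> by (auto simp: auto_def Bij_def bij_betw_def)
  then show "y \<in> \<phi> ` (same_nbrs (generating_graph G) `` {x})"
    using y \<phi> x same_nbrs_auto_iff by auto
next
  fix y assume "y \<in> \<phi> ` (same_nbrs (generating_graph G) `` {x})"
  then obtain z where z: "(x, z) \<in> same_nbrs (generating_graph G)" "y = \<phi> z"
    by auto
  then have "z \<in> carrier G"
    by (simp add: same_nbrs_generating_graph_iff)
  then show "y \<in> same_nbrs (generating_graph G) `` {\<phi> x}"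
    using z \<phi> x same_nbrs_auto_iff by auto
qed

lemma class_action_class:
  assumes "\<phi> \<in> auto G" "x \<in> carrier G"
  shows "class_action G \<phi> (same_nbrs (generating_graph G) `` {x}) =
    same_nbrs (generating_graph G) `` {\<phi> x}"
  using assms
  by (simp add: class_action_def pverts_reduced_generating_graph quotientI auto_image_class)

lemma class_action_in_Bij:
  assumes \<phi>: "\<phi> \<in> auto G"
  shows "class_action G \<phi> \<in> Bij (pverts (reduced_generating_graph G))"
proof -
  let ?R = "same_nbrs (generating_graph G)"
  have img: "\<phi> ` carrier G = carrier G" and inj: "inj_on \<phi> (carrier G)"
    using \<phi> by (auto simp: auto_def Bij_def bij_betw_def)
  have "inj_on ((`) \<phi>) (carrier G // ?R)"
  proof (rule inj_onI)
    fix C D assume "C \<in> carrier G // ?R" "D \<in> carrier G // ?R" "\<phi> ` C = \<phi> ` D"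
    then show "C = D"
      using inj_on_image_eq_iff [OF inj, of C D]
        in_quotient_imp_subset [OF equiv_same_nbrs [of "generating_graph G"]] by simp
  qed
  moreover have "(`) \<phi> ` (carrier G // ?R) = carrier G // ?R"
  proof -
    have Q: "carrier G // ?R = (\<lambda>x. ?R `` {x}) ` carrier G"
      by (auto simp: quotient_def)
    have "(`) \<phi> ` (carrier G // ?R) = (\<lambda>x. ?R `` {\<phi> x}) ` carrier G"
      unfolding Q image_image by (intro image_cong refl auto_image_class [OF \<phi>])
    also have "\<dots> = (\<lambda>x. ?R `` {x}) ` \<phi> ` carrier G"
      by (simp add: image_image)
    also have "\<dots> = carrier G // ?R"
      by (simp only: img Q)
    finally show ?thesis .
  qed
  ultimately show ?thesis
    by (simp add: Bij_def class_action_def pverts_reduced_generating_graph bij_betw_def)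
qed

text \<open>The target is the full symmetric group on the classes, whose group laws are at hand; the
  kernel criterion for injectivity asks for a group there. \<open>AutStar\<close> differs from it
  only in its carrier.\<close>

lemma class_action_hom:
  "class_action G \<in> hom (AutoGroup G) (BijGroup (pverts (reduced_generating_graph G)))"
proof (rule homI)
  fix \<phi> \<psi> assume "\<phi> \<in> carrier (AutoGroup G)" "\<psi> \<in> carrier (AutoGroup G)"
  then have \<phi>: "\<phi> \<in> auto G" and \<psi>: "\<psi> \<in> auto G"
    by (auto simp: AutoGroup_def)
  let ?V = "pverts (reduced_generating_graph G)"
  have comp: "compose (carrier G) \<phi> \<psi> \<in> auto G"
    using subgroup.m_closed [OF subgroup_auto \<phi> \<psi>] \<phi> \<psi> by (simp add: BijGroup_def auto_def)
  have "class_action G (compose (carrier G) \<phi> \<psi>) =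
    compose ?V (class_action G \<phi>) (class_action G \<psi>)"
  proof (rule extensionalityI [of _ ?V])
    fix C assume "C \<in> ?V"
    then obtain x where x: "x \<in> carrier G" and C: "C = same_nbrs (generating_graph G) `` {x}"
      by (auto simp: pverts_reduced_generating_graph quotient_def)
    moreover have "\<psi> x \<in> carrier G"
      using \<psi> x by (auto simp: auto_def hom_def)
    ultimately show "class_action G (compose (carrier G) \<phi> \<psi>) C =
      compose ?V (class_action G \<phi>) (class_action G \<psi>) C"
      using \<open>C \<in> ?V\<close> by (simp add: compose_eq class_action_class \<phi> \<psi> comp)
  qed (auto simp: class_action_def compose_def)
  then show "class_action G (\<phi> \<otimes>\<^bsub>AutoGroup G\<^esub> \<psi>) =
    class_action G \<phi> \<otimes>\<^bsub>BijGroup ?V\<^esub> class_action G \<psi>"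
    using \<phi> \<psi> class_action_in_Bij by (simp add: AutoGroup_def BijGroup_def auto_def)
qed (auto simp: AutoGroup_def BijGroup_def class_action_in_Bij)

lemma class_action_eq_one_iff:
  assumes \<phi>: "\<phi> \<in> auto G"
  shows "class_action G \<phi> = \<one>\<^bsub>BijGroup (pverts (reduced_generating_graph G))\<^esub> \<longleftrightarrow>
    (\<forall>x\<in>carrier G. (\<phi> x, x) \<in> same_nbrs (generating_graph G))"
    (is "?L \<longleftrightarrow> ?R")
proof -
  let ?S = "same_nbrs (generating_graph G)"
  have "?L \<longleftrightarrow> (\<forall>C\<in>carrier G // ?S. class_action G \<phi> C = C)"
    unfolding class_action_def BijGroup_def pverts_reduced_generating_graph
    by (auto simp: restrict_def fun_eq_iff)
  also have "\<dots> \<longleftrightarrow> (\<forall>x\<in>carrier G. ?S `` {\<phi> x} = ?S `` {x})"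
    using class_action_class [OF \<phi>] by (simp add: quotient_def)
  also have "\<dots> \<longleftrightarrow> ?R"
    using eq_equiv_class_iff [OF equiv_same_nbrs [of "generating_graph G"]] \<phi>
    by (auto simp: auto_def hom_def Pi_iff)
  finally show ?thesis .
qed

text \<open>Surjectivity is built into \<open>AutStar\<close>, whose carrier is the image of the
  action, so being an isomorphism amounts to having trivial kernel.\<close>

lemma AutStar_eq_Aut_iff:
  "AutStar_eq_Aut G \<longleftrightarrow>
    (\<forall>\<phi>\<in>auto G. (\<forall>x\<in>carrier G. (\<phi> x, x) \<in> same_nbrs (generating_graph G)) \<longrightarrow>
       \<phi> = (\<lambda>x\<in>carrier G. x))"
proof -
  let ?B = "BijGroup (pverts (reduced_generating_graph G))"
  have "class_action G \<in> hom (AutoGroup G) (AutStar G)"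
    using class_action_hom by (auto simp: AutStar_def hom_def)
  then have "AutStar_eq_Aut G \<longleftrightarrow> inj_on (class_action G) (carrier (AutoGroup G))"
    by (simp add: AutStar_eq_Aut_def iso_def bij_betw_def AutStar_def)
  also have "\<dots> \<longleftrightarrow> (\<forall>\<phi>. \<phi> \<in> carrier (AutoGroup G) \<longrightarrow> class_action G \<phi> = \<one>\<^bsub>?B\<^esub> \<longrightarrow>
      \<phi> = \<one>\<^bsub>AutoGroup G\<^esub>)"
    by (rule inj_on_one_iff' [OF class_action_hom AutoGroup group_BijGroup])
  also have "carrier (AutoGroup G) = auto G"
    by (simp add: AutoGroup_def)
  also have "\<one>\<^bsub>AutoGroup G\<^esub> = (\<lambda>x\<in>carrier G. x)"
    by (simp add: AutoGroup_def BijGroup_def)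
  finally show ?thesis
    using class_action_eq_one_iff by blast
qed

section \<open>Nonabelian groups\<close>

lemma minimal_normal_subgroup_exists:
  assumes fin: "finite (carrier G)" and L: "L \<lhd> G" "L \<noteq> {\<one>}"
  obtains N where "N \<lhd> G" "N \<noteq> {\<one>}" "N \<subseteq> L"
    "\<And>M. M \<lhd> G \<Longrightarrow> M \<subseteq> N \<Longrightarrow> M \<noteq> {\<one>} \<Longrightarrow> M = N"
proof -
  let ?F = "{M. M \<lhd> G \<and> M \<noteq> {\<one>}}"
  have "?F \<subseteq> Pow (carrier G)"
    using normal_imp_subgroup subgroup.subset by blast
  then have "finite ?F"
    using fin by (meson finite_Pow_iff finite_subset)
  moreover have "L \<in> ?F"
    using L by simp
  ultimately obtain N where "N \<in> ?F" "N \<subseteq> L" and min: "\<forall>M\<in>?F. M \<subseteq> N \<longrightarrow> N = M"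
    by (rule finite_has_minimal2 [THEN bexE]) (elim conjE)
  show thesis
  proof (rule that)
    show "M = N" if "M \<lhd> G" "M \<subseteq> N" "M \<noteq> {\<one>}" for M
      using min [rule_format, of M] that by simp
  qed (use \<open>N \<in> ?F\<close> \<open>N \<subseteq> L\<close> in simp_all)
qed

text \<open>\<open>L\<close> is the kernel of the conjugation action of \<open>G\<close> on the
  classes.\<close>

lemma normal_subgroup_class_conj:
  defines "L \<equiv> {h \<in> carrier G. \<forall>x\<in>carrier G.
    (h \<otimes> x \<otimes> inv h, x) \<in> same_nbrs (generating_graph G)}"
  shows "L \<lhd> G"
proof (rule normal_invI)
  let ?R = "same_nbrs (generating_graph G)"
  have tr: "(a, c) \<in> ?R" if "(a, b) \<in> ?R" "(b, c) \<in> ?R" for a b c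
    using that by (auto simp: same_nbrs_def)
  have sy: "(b, a) \<in> ?R" if "(a, b) \<in> ?R" for a b
    using that by (auto simp: same_nbrs_def)
  show sub: "subgroup L G"
  proof (rule subgroupI)
    have "\<one> \<in> L" by (auto simp: L_def same_nbrs_generating_graph_iff)
    then show "L \<noteq> {}" by blast
  next
    fix a assume a: "a \<in> L"
    have "(inv a \<otimes> x \<otimes> inv (inv a), x) \<in> ?R" if x: "x \<in> carrier G" for x
    proof (rule sy)
      \<comment> \<open>The property of \<open>a\<close> is applied to the conjugate of
        \<open>x\<close> that \<open>a\<close> sends back to \<open>x\<close>.\<close>
      have "(a \<otimes> (inv a \<otimes> x \<otimes> a) \<otimes> inv a, inv a \<otimes> x \<otimes> a) \<in> ?R"
        using a x by (auto simp: L_def)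
      moreover have "a \<otimes> (inv a \<otimes> x \<otimes> a) \<otimes> inv a = x"
        using a x by (simp add: L_def m_assoc inv_cancel_left)
      ultimately show "(x, inv a \<otimes> x \<otimes> inv (inv a)) \<in> ?R"
        using a by (simp add: L_def)
    qed
    then show "inv a \<in> L" using a by (simp add: L_def)
  next
    fix a b assume a: "a \<in> L" and b: "b \<in> L"
    have "(a \<otimes> b \<otimes> x \<otimes> inv (a \<otimes> b), x) \<in> ?R" if x: "x \<in> carrier G" for x
    proof -
      have "(a \<otimes> (b \<otimes> x \<otimes> inv b) \<otimes> inv a, b \<otimes> x \<otimes> inv b) \<in> ?R" "(b \<otimes> x \<otimes> inv b, x) \<in> ?R"
        using a b x by (auto simp: L_def)
      moreover have "a \<otimes> (b \<otimes> x \<otimes> inv b) \<otimes> inv a = a \<otimes> b \<otimes> x \<otimes> inv (a \<otimes> b)"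
        using a b x by (simp add: L_def m_assoc inv_mult_group)
      ultimately show ?thesis using tr by metis
    qed
    then show "a \<otimes> b \<in> L" using a b by (simp add: L_def)
  qed (auto simp: L_def)
  fix g h assume g: "g \<in> carrier G" and h: "h \<in> L"
  have "(g \<otimes> h \<otimes> inv g \<otimes> x \<otimes> inv (g \<otimes> h \<otimes> inv g), x) \<in> ?R" if x: "x \<in> carrier G" for x
  proof -
    let ?y = "inv g \<otimes> x \<otimes> g"
    \<comment> \<open>The property of \<open>h\<close> at \<open>?y\<close> is transported by
      conjugation with \<open>g\<close>, which preserves the relation and sends \<open>?y\<close> to
      \<open>x\<close>.\<close>
    have "(h \<otimes> ?y \<otimes> inv h, ?y) \<in> ?R"
      using h g x by (auto simp: L_def)
    then have "(g \<otimes> (h \<otimes> ?y \<otimes> inv h) \<otimes> inv g, g \<otimes> ?y \<otimes> inv g) \<in> ?R"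
      using h g x by (subst same_nbrs_conj_iff) (auto simp: L_def)
    moreover have "g \<otimes> ?y \<otimes> inv g = x"
      using g x by (simp add: m_assoc inv_cancel_left)
    moreover have "g \<otimes> (h \<otimes> ?y \<otimes> inv h) \<otimes> inv g = g \<otimes> h \<otimes> inv g \<otimes> x \<otimes> inv (g \<otimes> h \<otimes> inv g)"
      using g h x by (simp add: L_def m_assoc inv_mult_group)
    ultimately show ?thesis by simp
  qed
  then show "g \<otimes> h \<otimes> inv g \<in> L" using g h by (simp add: L_def)
qed

lemma comm_group_if_class_conj:
  assumes fin: "finite (carrier G)" and spread: "nonzero_spread G"
    and L: "L \<lhd> G" "L \<noteq> {\<one>}"
    and conj: "\<And>n x. n \<in> L \<Longrightarrow> x \<in> carrier G \<Longrightarrow>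
      (n \<otimes> x \<otimes> inv n, x) \<in> same_nbrs (generating_graph G)"
  shows "comm_group G"
proof -
  obtain N where N: "N \<lhd> G" "N \<noteq> {\<one>}" "N \<subseteq> L"
    and minimal: "\<And>M. M \<lhd> G \<Longrightarrow> M \<subseteq> N \<Longrightarrow> M \<noteq> {\<one>} \<Longrightarrow> M = N"
    using minimal_normal_subgroup_exists [OF fin L] by blast
  interpret N: normal N G by (rule N(1))
  obtain s where s: "s \<in> N" "s \<noteq> \<one>"
    using N(2) N.one_closed by blast
  then obtain x where x: "x \<in> carrier G" and gen: "generate G {x, s} = carrier G"
    using spread N.subset unfolding nonzero_spread_def by blast
  define P where "P w \<longleftrightarrow> generate G {x, w} = carrier G" for w
  \<comment> \<open>Equivalent elements agree on being adjacent to the particular vertex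
    \<open>x\<close>.\<close>
  have P_conj: "P (n \<otimes> w \<otimes> inv n) \<longleftrightarrow> P w" if "n \<in> N" "w \<in> carrier G" for n w
    unfolding P_def insert_commute [of x]
    using conj [of n w] that x N(3) by (simp add: same_nbrs_generating_graph_iff subset_iff)
  \<comment> \<open>Words may be rotated: conjugation by \<open>n\<close> carries a factor
    \<open>n\<close> from the end to the front.\<close>
  have P_conj': "P (w \<otimes> n) \<longleftrightarrow> P (n \<otimes> w)" if "n \<in> N" "w \<in> carrier G" for n w
    using P_conj [of n "w \<otimes> n"] that by (simp add: m_assoc)
  have P_mult: "P (w \<otimes> x) \<longleftrightarrow> P w" if "w \<in> carrier G" for w
    using generate_pair_mult x that by (simp add: P_def)
  have P_mult': "P (w \<otimes> inv x) \<longleftrightarrow> P w" if "w \<in> carrier G" for w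
    using P_mult [of "w \<otimes> inv x"] x that by (simp add: m_assoc)
  define T where "T = {m \<in> N. \<forall>w\<in>carrier G. P (w \<otimes> m) \<longleftrightarrow> P w}"
  have T_subset: "T \<subseteq> N" by (auto simp: T_def)
  have PT: "P (w \<otimes> m) \<longleftrightarrow> P w" if "m \<in> T" "w \<in> carrier G" for m w
    using that by (auto simp: T_def)
  have subT: "subgroup T G"
  proof (rule subgroupI)
    have "\<one> \<in> T" by (simp add: T_def)
    then show "T \<noteq> {}" by blast
  next
    fix a assume a: "a \<in> T"
    have "P (w \<otimes> inv a) \<longleftrightarrow> P w" if w: "w \<in> carrier G" for w
      using PT [OF a, of "w \<otimes> inv a"] a T_subset w by (auto simp: m_assoc subset_iff)
    then show "inv a \<in> T" using a by (simp add: T_def)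
  next
    fix a b assume a: "a \<in> T" and b: "b \<in> T"
    have "P (w \<otimes> (a \<otimes> b)) \<longleftrightarrow> P w" if w: "w \<in> carrier G" for w
      using PT [OF b, of "w \<otimes> a"] PT [OF a w] a b T_subset w
      by (auto simp: m_assoc subset_iff)
    then show "a \<otimes> b \<in> T" using a b by (simp add: T_def)
  qed (use T_subset N.subset in auto)
  \<comment> \<open>Rotate \<open>inv n\<close> to the front, drop the now final \<open>m\<close>,
    then rotate \<open>n\<close> to the front, where it cancels.\<close>
  have T_conj_N: "n \<otimes> m \<otimes> inv n \<in> T" if m: "m \<in> T" and n: "n \<in> N" for m n
  proof -
    have "P (w \<otimes> (n \<otimes> m \<otimes> inv n)) \<longleftrightarrow> P w" if w: "w \<in> carrier G" for w
    proof -
      have [simp]: "m \<in> carrier G" "n \<in> carrier G" using m n T_subset by auto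
      have "P (w \<otimes> (n \<otimes> m \<otimes> inv n)) \<longleftrightarrow> P ((w \<otimes> n \<otimes> m) \<otimes> inv n)"
        using w by (simp add: m_assoc)
      also have "\<dots> \<longleftrightarrow> P ((inv n \<otimes> w \<otimes> n) \<otimes> m)"
        using w n by (subst P_conj') (simp_all add: m_assoc)
      also have "\<dots> \<longleftrightarrow> P ((inv n \<otimes> w) \<otimes> n)"
        using w m by (simp add: PT)
      also have "\<dots> \<longleftrightarrow> P w"
        using w n by (subst P_conj') (simp_all add: m_assoc [symmetric])
      finally show ?thesis .
    qed
    then show ?thesis using m n T_subset by (auto simp: T_def)
  qed
  have T_conj_x: "x \<otimes> m \<otimes> inv x \<in> T" "inv x \<otimes> m \<otimes> x \<in> T" if m: "m \<in> T" for m
  proof -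
    have [simp]: "m \<in> carrier G" using m T_subset by auto
    have "P (w \<otimes> (x \<otimes> m \<otimes> inv x)) \<longleftrightarrow> P w" if w: "w \<in> carrier G" for w
      using P_mult' [of "w \<otimes> x \<otimes> m"] PT [OF m, of "w \<otimes> x"] P_mult [OF w] w x
      by (simp add: m_assoc)
    then show "x \<otimes> m \<otimes> inv x \<in> T"
      using m x N.inv_op_closed2 by (simp add: T_def)
    have "P (w \<otimes> (inv x \<otimes> m \<otimes> x)) \<longleftrightarrow> P w" if w: "w \<in> carrier G" for w
      using P_mult [of "w \<otimes> inv x \<otimes> m"] PT [OF m, of "w \<otimes> inv x"] P_mult' [OF w] w x
      by (simp add: m_assoc)
    then show "inv x \<otimes> m \<otimes> x \<in> T"
      using m x N.inv_op_closed1 by (simp add: T_def)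
  qed
  \<comment> \<open>Since \<open>x\<close> and \<open>s\<close> generate \<open>G\<close> and
    \<open>s\<close> lies in \<open>N\<close>, the two kinds of conjugation above suffice for
    normality.\<close>
  have T_conj: "\<forall>m\<in>T. g \<otimes> m \<otimes> inv g \<in> T" if "g \<in> generate G {x, s}" for g
    using that
  proof (induction rule: generate.induct)
    case one
    then show ?case using T_subset by auto
  next
    case (incl h)
    then show ?case using T_conj_x T_conj_N s by auto
  next
    case (inv h)
    then show ?case using T_conj_x T_conj_N [of _ "inv s"] s x by auto
  next
    case (eng a b)
    have ab: "a \<in> carrier G" "b \<in> carrier G"
      using eng gen by auto
    show ?case
    proof
      fix m assume m: "m \<in> T"
      then have "a \<otimes> (b \<otimes> m \<otimes> inv b) \<otimes> inv a \<in> T" using eng.IH by blast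
      moreover have "a \<otimes> (b \<otimes> m \<otimes> inv b) \<otimes> inv a = a \<otimes> b \<otimes> m \<otimes> inv (a \<otimes> b)"
        using ab m T_subset by (auto simp: m_assoc inv_mult_group subset_iff)
      ultimately show "a \<otimes> b \<otimes> m \<otimes> inv (a \<otimes> b) \<in> T" by simp
    qed
  qed
  have T_normal: "T \<lhd> G"
    by (rule normal_invI [OF subT]) (use T_conj gen in auto)
  \<comment> \<open>Rotating \<open>inv n\<close> to the front exposes \<open>inv x\<close>, which
    is dropped; rotating \<open>n\<close> then cancels it and leaves \<open>w \<otimes> x\<close>, a
    partner exactly when \<open>w\<close> is.\<close>
  have commutator: "x \<otimes> n \<otimes> inv x \<otimes> inv n \<in> T" if n: "n \<in> N" for n
  proof -
    have [simp]: "n \<in> carrier G" using n by auto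
    have "P (w \<otimes> (x \<otimes> n \<otimes> inv x \<otimes> inv n)) \<longleftrightarrow> P w" if w: "w \<in> carrier G" for w
    proof -
      have "P (w \<otimes> (x \<otimes> n \<otimes> inv x \<otimes> inv n)) \<longleftrightarrow> P ((w \<otimes> x \<otimes> n \<otimes> inv x) \<otimes> inv n)"
        using w x by (simp add: m_assoc)
      also have "\<dots> \<longleftrightarrow> P ((inv n \<otimes> w \<otimes> x \<otimes> n) \<otimes> inv x)"
        using w x n by (subst P_conj') (simp_all add: m_assoc)
      also have "\<dots> \<longleftrightarrow> P ((inv n \<otimes> w \<otimes> x) \<otimes> n)"
        using w x by (simp add: P_mult')
      also have "\<dots> \<longleftrightarrow> P (w \<otimes> x)"
        using w x n by (subst P_conj') (simp_all add: m_assoc inv_cancel_left)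
      also have "\<dots> \<longleftrightarrow> P w"
        using w by (rule P_mult)
      finally show ?thesis .
    qed
    moreover have "x \<otimes> n \<otimes> inv x \<otimes> inv n \<in> N"
      using n x N.inv_op_closed2 by simp
    ultimately show ?thesis by (simp add: T_def)
  qed
  show ?thesis
  proof (cases "T = {\<one>}")
    case True
    have [simp]: "s \<in> carrier G" using s by auto
    have "x \<otimes> s \<otimes> inv x \<otimes> inv s = \<one>"
      using commutator [OF s(1)] True by simp
    then have "x \<otimes> s \<otimes> inv (s \<otimes> x) = \<one>"
      using x by (simp add: inv_mult_group m_assoc)
    then have "x \<otimes> s = s \<otimes> x"
      using x by (simp add: inv_solve_right')
    then show ?thesis
      using comm_group_generating_pair [OF x _ gen] by simp
  next
    case False
    then have "T = N" using minimal T_normal T_subset by blast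
    \<comment> \<open>Multiplying the partner \<open>s\<close> by \<open>inv s\<close> makes \<one>
      a partner of \<open>x\<close>, so \<open>x\<close> alone generates \<open>G\<close>.\<close>
    then have "inv s \<in> T" using s by simp
    then have "P (s \<otimes> inv s)" using PT [of "inv s" s] s gen by (simp add: P_def)
    then have "P \<one>" using s by simp
    then show ?thesis
      using comm_group_generating_pair [of x \<one>] x by (simp add: P_def)
  qed
qed

text \<open>Conjugation by \<open>?h\<close> is the commutator of \<alpha> with conjugation by
  \<open>g\<close>. It acts trivially on the classes because \<alpha> does, and \<open>?h\<close> is
  not \<one> because \<alpha> moves \<open>g\<close>.\<close>

lemma auto_trivial_if_nonabelian:
  assumes fin: "finite (carrier G)" and spread: "nonzero_spread G"
    and nonab: "\<not> comm_group G" and \<alpha>: "\<alpha> \<in> auto G"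
    and fixes_classes: "\<And>x. x \<in> carrier G \<Longrightarrow> (\<alpha> x, x) \<in> same_nbrs (generating_graph G)"
  shows "\<alpha> = (\<lambda>x\<in>carrier G. x)"
proof (rule ccontr)
  let ?R = "same_nbrs (generating_graph G)"
  interpret \<alpha>: group_hom G G \<alpha>
    by unfold_locales (use \<alpha> in \<open>simp add: auto_def\<close>)
  define L where "L = {h \<in> carrier G. \<forall>x\<in>carrier G. (h \<otimes> x \<otimes> inv h, x) \<in> ?R}"
  assume "\<alpha> \<noteq> (\<lambda>x\<in>carrier G. x)"
  moreover have "\<alpha> = (\<lambda>x\<in>carrier G. x)" if "\<forall>g\<in>carrier G. \<alpha> g = g"
    by (rule extensionalityI [of _ "carrier G"]) (use \<alpha> that in \<open>simp_all add: auto_def Bij_def\<close>)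
  ultimately obtain g where g: "g \<in> carrier G" "\<alpha> g \<noteq> g"
    by blast
  let ?h = "\<alpha> g \<otimes> inv g"
  have "(?h \<otimes> x \<otimes> inv ?h, x) \<in> ?R" if x: "x \<in> carrier G" for x
  proof -
    \<comment> \<open>The preimage \<open>w\<close> is chosen so that both \<open>x\<close> and its
      conjugate by \<open>?h\<close> are equivalent to
      \<open>g \<otimes> w \<otimes> inv g\<close>.\<close>
    have "inv g \<otimes> x \<otimes> g \<in> \<alpha> ` carrier G"
      using \<alpha> g x by (auto simp: auto_def Bij_def bij_betw_def)
    then obtain w where w: "w \<in> carrier G" "\<alpha> w = inv g \<otimes> x \<otimes> g"
      by auto
    have "(g \<otimes> \<alpha> w \<otimes> inv g, g \<otimes> w \<otimes> inv g) \<in> ?R"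
      using g w(1) fixes_classes same_nbrs_conj_iff by simp
    moreover have "g \<otimes> \<alpha> w \<otimes> inv g = x"
      using g x by (simp add: w(2) m_assoc inv_cancel_left)
    moreover have "(\<alpha> (g \<otimes> w \<otimes> inv g), g \<otimes> w \<otimes> inv g) \<in> ?R"
      using g w(1) by (intro fixes_classes) auto
    moreover have "\<alpha> (g \<otimes> w \<otimes> inv g) = ?h \<otimes> x \<otimes> inv ?h"
      using g x w by (simp add: m_assoc inv_mult_group)
    ultimately show ?thesis
      by (auto simp: same_nbrs_def)
  qed
  then have "?h \<in> L" using g by (simp add: L_def)
  moreover have "?h \<noteq> \<one>"
    using g by (simp add: inv_solve_right')
  ultimately have nontrivial: "L \<noteq> {\<one>}" by blast
  have normal: "L \<lhd> G"
    unfolding L_def by (rule normal_subgroup_class_conj)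
  have "comm_group G"
    by (rule comm_group_if_class_conj [OF fin spread normal nontrivial]) (simp add: L_def)
  with nonab show False by contradiction
qed

section \<open>Abelian groups\<close>

text \<open>An element and its inverse generate the same subgroup with any \<open>z\<close>. This
  puts inversion into the kernel once \<open>G\<close> is abelian.\<close>

lemma same_nbrs_inv:
  assumes "x \<in> carrier G"
  shows "(inv x, x) \<in> same_nbrs (generating_graph G)"
proof -
  have "generate G {inv x, z} = generate G {x, z}" if "z \<in> carrier G" for z
  proof (rule generate_pair_eqI)
    show "x \<in> generate G {inv x, z}"
      using generate.inv [of "inv x" "{inv x, z}" G] assms by simp
  qed (use assms that in \<open>auto intro: generate.intros\<close>)
  then show ?thesis
    using assms by (simp add: same_nbrs_generating_graph_iff)
qed

text \<open>The listed set is closed under products because squares vanish and factors commute. Its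
  members may coincide; the next lemma separates the cases.\<close>

lemma carrier_exponent_two:
  assumes comm: "comm_group G" and sq: "\<And>x. x \<in> carrier G \<Longrightarrow> inv x = x"
    and x: "x \<in> carrier G" and s: "s \<in> carrier G" and gen: "generate G {x, s} = carrier G"
  shows "carrier G = {\<one>, x, s, x \<otimes> s}"
proof -
  interpret comm_group G by (rule comm)
  have sq': "a \<otimes> a = \<one>" if "a \<in> carrier G" for a
    using sq [OF that] r_inv [OF that] by simp
  \<comment> \<open>This cancels a repeated factor inside a right-nested product, the shape that
    \<open>m_ac\<close> produces.\<close>
  have sq'': "a \<otimes> (a \<otimes> b) = b" if "a \<in> carrier G" "b \<in> carrier G" for a b
    using that by (simp add: m_assoc [symmetric] sq')
  have "a \<in> {\<one>, x, s, x \<otimes> s}" if "a \<in> generate G {x, s}" for a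
    using that
  proof (induction rule: generate.induct)
    case (eng a b)
    then show ?case
      using x s by (auto simp: sq' sq'' m_ac)
  qed (use x s sq in auto)
  then show ?thesis using gen x s by auto
qed

end

lemma exponent_two_cases:
  assumes "comm_group G" and spread: "nonzero_spread G"
    and sq: "\<And>x. x \<in> carrier G \<Longrightarrow> inv\<^bsub>G\<^esub> x = x"
  shows "G \<cong> integer_mod_group 1 \<or> G \<cong> integer_mod_group 2 \<or>
    G \<cong> integer_mod_group 2 \<times>\<times> integer_mod_group 2"
proof -
  interpret comm_group G by fact
  have sq': "a \<otimes>\<^bsub>G\<^esub> a = \<one>\<^bsub>G\<^esub>" if "a \<in> carrier G" for a
    using sq [OF that] r_inv [OF that] by simp
  have sq'': "a \<otimes>\<^bsub>G\<^esub> (a \<otimes>\<^bsub>G\<^esub> b) = b" if "a \<in> carrier G" "b \<in> carrier G" for a b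
    using that by (simp add: m_assoc [symmetric] sq')
  have Z2: "carrier (integer_mod_group 2) = {0, 1}"
    by (auto simp: carrier_integer_mod_group)
  show ?thesis
  proof (cases "carrier G = {\<one>\<^bsub>G\<^esub>}")
    case True
    then have "(\<lambda>_. 0) \<in> iso G (integer_mod_group 1)"
      by (auto simp: iso_def hom_def bij_betw_def carrier_integer_mod_group)
    then show ?thesis by (auto simp: is_iso_def)
  next
    case False
    then obtain s where s: "s \<in> carrier G" "s \<noteq> \<one>\<^bsub>G\<^esub>" by blast
    then obtain x where x: "x \<in> carrier G" and gen: "generate G {x, s} = carrier G"
      using spread unfolding nonzero_spread_def by blast
    have G: "carrier G = {\<one>\<^bsub>G\<^esub>, x, s, x \<otimes>\<^bsub>G\<^esub> s}"
      by (rule carrier_exponent_two) (use assms x s gen in auto)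
    show ?thesis
    proof (cases "x \<in> {\<one>\<^bsub>G\<^esub>, s}")
      \<comment> \<open>If \<open>x\<close> is \<one> or \<open>s\<close>, the list of four
        collapses to \<one> and \<open>s\<close>.\<close>
      case True
      then have "x \<otimes>\<^bsub>G\<^esub> s \<in> {\<one>\<^bsub>G\<^esub>, s}"
        using s sq' by (elim insertE) simp_all
      with True have G2: "carrier G = {\<one>\<^bsub>G\<^esub>, s}"
        unfolding G by blast
      have "(\<lambda>i. if i = 0 then \<one>\<^bsub>G\<^esub> else s) \<in> iso (integer_mod_group 2) G"
        using s by (auto simp: iso_def hom_def bij_betw_def inj_on_def Z2 G2 sq')
      then have "integer_mod_group 2 \<cong> G" by (auto simp: is_iso_def)
      then show ?thesis by (simp add: group.iso_sym)
    next
      case False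
      \<comment> \<open>The map sends \<open>(i, j)\<close> to the product of the
        \<open>i\<close>-th power of \<open>x\<close> and the \<open>j\<close>-th power of
        \<open>s\<close>.\<close>
      let ?f = "\<lambda>(i, j). (if i = 0 then \<one>\<^bsub>G\<^esub> else x) \<otimes>\<^bsub>G\<^esub> (if j = 0 then \<one>\<^bsub>G\<^esub> else s)"
      have ne: "x \<otimes>\<^bsub>G\<^esub> s \<noteq> \<one>\<^bsub>G\<^esub>" "x \<otimes>\<^bsub>G\<^esub> s \<noteq> x" "x \<otimes>\<^bsub>G\<^esub> s \<noteq> s"
        using False x s sq'' [of x s] by auto
      have "?f \<in> hom (integer_mod_group 2 \<times>\<times> integer_mod_group 2) G"
        using x s by (auto simp: hom_def DirProd_def Z2 sq' sq'' m_ac)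
      moreover have "bij_betw ?f (carrier (integer_mod_group 2 \<times>\<times> integer_mod_group 2)) (carrier G)"
      proof (rule bij_betw_imageI)
        have Z22: "carrier (integer_mod_group 2 \<times>\<times> integer_mod_group 2) =
          {(0, 0), (0, 1), (1, 0), (1, 1)}"
          by (auto simp: DirProd_def Z2)
        show "inj_on ?f (carrier (integer_mod_group 2 \<times>\<times> integer_mod_group 2))"
          unfolding Z22 using x s ne ne [symmetric] False by simp
        show "?f ` carrier (integer_mod_group 2 \<times>\<times> integer_mod_group 2) = carrier G"
          unfolding Z22 using x s by simp (subst G, blast)
      qed
      ultimately have "integer_mod_group 2 \<times>\<times> integer_mod_group 2 \<cong> G"
        by (auto simp: is_iso_def iso_def)
      then show ?thesis by (simp add: group.iso_sym DirProd_group)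
    qed
  qed
qed

text \<open>The three excluded groups are abelian and yet satisfy the equality: the first two have
  no nontrivial automorphism, and in the Klein four-group every class is a singleton.\<close>

theorem theorem5p10:
  fixes G :: "('a, 'b) monoid_scheme"
  assumes "group G"
    and "finite (carrier G)"
    and "nonzero_spread G"
    and "\<not> G \<cong> integer_mod_group 1"
    and "\<not> G \<cong> integer_mod_group 2"
    and "\<not> G \<cong> integer_mod_group 2 \<times>\<times> integer_mod_group 2"
  shows "AutStar_eq_Aut G \<longleftrightarrow> \<not> comm_group G"
proof
  interpret group G by fact
  show "\<not> comm_group G" if faithful: "AutStar_eq_Aut G"
  proof
    assume comm: "comm_group G"
    then interpret comm_group G .
    \<comment> \<open>Commutativity makes inversion a homomorphism. It fixes every class, so
      faithfulness forces exponent dividing two.\<close>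
    let ?inv = "\<lambda>x\<in>carrier G. inv\<^bsub>G\<^esub> x"
    have "bij_betw ?inv (carrier G) (carrier G)"
      by (rule bij_betwI [where g = ?inv]) auto
    then have "?inv \<in> auto G"
      by (auto simp: auto_def Bij_def hom_def inv_mult)
    then have "?inv = (\<lambda>x\<in>carrier G. x)"
      using faithful same_nbrs_inv by (simp add: AutStar_eq_Aut_iff)
    then have "inv\<^bsub>G\<^esub> x = x" if "x \<in> carrier G" for x
      using that by (metis restrict_apply')
    then show False
      using exponent_two_cases [OF comm] assms by blast
  qed
  show "AutStar_eq_Aut G" if "\<not> comm_group G"
    using auto_trivial_if_nonabelian [OF assms(2,3) that] by (auto simp: AutStar_eq_Aut_iff)
qed

end
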